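(* Let $S$ be a poset, let $\mathcal{O}S$ be the frame of upsets of $S$, and let $N(\mathcal{O}S)$ be the frame of nuclei of $\mathcal{O}S$. Then $N(\mathcal{O}S)$ is not spatial if and only if the infinite binary tree $\mathscr{T}_2$ is isomorphic to a subposet of $S$.
   Context: An upset of a poset $S$ is a subset $U$ such that $s\in U$ and $s\le t$ imply $t\in U$; $\mathcal{O}S$ is the set of upsets ordered by inclusion (this is the frame of open sets of $S$ viewed as an Alexandroff $T_0$-space). A nucleus on a frame $L$ is a map $j:L\to L$ with $a\le j(a)$, $j(j(a))=j(a)$, and $j(a\wedge b)=j(a)\wedge j(b)$ for all $a,b\in L$; the set $N(L)$ of nuclei on $L$, ordered pointwise, is a frame. A frame is spatial if it is isomorphic to the frame of open sets of some topological space. The infinite binary tree $\mathscr{T}_2$ is the poset of all finite sequences of elements of $\{0,1\}$ ordered by the initial-segment (prefix) relation; its root, the empty sequence, is its least element. A subposet is a subset with the induced order. *)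

theory Defs
  imports "HOL-Analysis.Abstract_Topology" "HOL-Algebra.Lattice" "HOL-Library.Sublist"
begin

definition order_isomorphic ::
    "('a, 'c) gorder_scheme \<Rightarrow> ('b, 'd) gorder_scheme \<Rightarrow> bool" where
  "order_isomorphic L M \<longleftrightarrow>
     (\<exists>f. bij_betw f (carrier L) (carrier M) \<and>
          (\<forall>x\<in>carrier L. \<forall>y\<in>carrier L. x \<sqsubseteq>\<^bsub>L\<^esub> y \<longleftrightarrow> f x \<sqsubseteq>\<^bsub>M\<^esub> f y))"

definition subposet :: "'a gorder \<Rightarrow> 'a set \<Rightarrow> 'a gorder" where
  "subposet S A = S\<lparr>carrier := A\<rparr>"

definition upset :: "'a gorder \<Rightarrow> 'a set \<Rightarrow> bool" where
  "upset S U \<longleftrightarrow> U \<subseteq> carrier S \<and> (\<forall>s\<in>U. \<forall>t\<in>carrier S. s \<sqsubseteq>\<^bsub>S\<^esub> t \<longrightarrow> t \<in> U)"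

definition upset_frame :: "'a gorder \<Rightarrow> 'a set gorder" where
  "upset_frame S = \<lparr>carrier = {U. upset S U}, eq = (=), le = (\<subseteq>)\<rparr>"

definition nucleus :: "'a gorder \<Rightarrow> ('a \<Rightarrow> 'a) \<Rightarrow> bool" where
  "nucleus L j \<longleftrightarrow>
     j \<in> carrier L \<rightarrow> carrier L \<and>
     (\<forall>a\<in>carrier L. a \<sqsubseteq>\<^bsub>L\<^esub> j a) \<and>
     (\<forall>a\<in>carrier L. j (j a) = j a) \<and>
     (\<forall>a\<in>carrier L. \<forall>b\<in>carrier L. j (a \<sqinter>\<^bsub>L\<^esub> b) = j a \<sqinter>\<^bsub>L\<^esub> j b)"

text \<open>Nuclei are taken to be extensional (\<open>undefined\<close> off the carrier), so that maps which agree
  on the carrier of \<open>L\<close> are equal and the pointwise order is antisymmetric.\<close>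

definition nuclei_frame :: "'a gorder \<Rightarrow> ('a \<Rightarrow> 'a) gorder" where
  "nuclei_frame L =
     \<lparr>carrier = {j \<in> extensional (carrier L). nucleus L j}, eq = (=),
      le = (\<lambda>j k. \<forall>a\<in>carrier L. j a \<sqsubseteq>\<^bsub>L\<^esub> k a)\<rparr>"

definition open_set_frame :: "'p topology \<Rightarrow> 'p set gorder" where
  "open_set_frame X = \<lparr>carrier = {U. openin X U}, eq = (=), le = (\<subseteq>)\<rparr>"

text \<open>HOL cannot quantify over the type of points inside a formula. Sets of elements of \<open>L\<close> suffice
  as points: by \<open>spatial_if_order_isomorphic\<close> below, an isomorphism with the open sets of a space
  over any type whatsoever makes \<open>L\<close> spatial. An order isomorphism between frames preserves all
  existing meets and joins, so it is the same thing as a frame isomorphism; and \<open>L\<close> is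
  automatically a frame if it is order isomorphic to one.\<close>

definition spatial :: "'a gorder \<Rightarrow> bool" where
  "spatial L \<longleftrightarrow> (\<exists>X :: 'a set topology. order_isomorphic L (open_set_frame X))"

definition binary_tree :: "bool list gorder" where
  "binary_tree = \<lparr>carrier = UNIV, eq = (=), le = prefix\<rparr>"

lemma spatial_if_order_isomorphic:
  fixes L :: "'a gorder" and Y :: "'p topology"
  assumes "order_isomorphic L (open_set_frame Y)"
  shows "spatial L"
proof -
  obtain f where f: "bij_betw f (carrier L) {U. openin Y U}"
    and f_le: "\<And>a b. a \<in> carrier L \<Longrightarrow> b \<in> carrier L \<Longrightarrow> a \<sqsubseteq>\<^bsub>L\<^esub> b \<longleftrightarrow> f a \<subseteq> f b"
    using assms unfolding order_isomorphic_def open_set_frame_def by auto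
  define P where "P y = {a \<in> carrier L. y \<in> f a}" for y
  define pre where "pre U = {y \<in> topspace Y. P y \<in> U}" for U
  define Q where "Q U \<longleftrightarrow> U \<subseteq> P ` topspace Y \<and> openin Y (pre U)" for U
  have ist: "istopology Q"
    unfolding istopology_def
  proof (intro conjI allI impI)
    fix S T assume "Q S" "Q T"
    moreover have "pre (S \<inter> T) = pre S \<inter> pre T"
      by (auto simp: pre_def)
    ultimately show "Q (S \<inter> T)"
      by (auto simp: Q_def)
  next
    fix \<K> assume "\<forall>K\<in>\<K>. Q K"
    moreover have "pre (\<Union>\<K>) = (\<Union>K\<in>\<K>. pre K)"
      by (auto simp: pre_def)
    ultimately show "Q (\<Union>\<K>)"
      by (auto simp: Q_def)
  qed
  define X where "X = topology Q"
  have open_X: "openin X U \<longleftrightarrow> Q U" for U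
    unfolding X_def using ist by (simp add: topology_inverse')
  have f_sub: "f a \<subseteq> topspace Y" and f_open: "openin Y (f a)" if "a \<in> carrier L" for a
    using f that openin_subset by (auto simp: bij_betw_def)
  have pre_image: "pre (P ` f a) = f a" if "a \<in> carrier L" for a
    using f_sub[OF that] that by (auto simp: pre_def P_def)
  have image_pre: "P ` pre U = U" if "Q U" for U
    using that by (auto simp: pre_def Q_def)
  let ?g = "\<lambda>a. P ` f a"
  have "inj_on ?g (carrier L)"
    by (rule inj_onI) (metis pre_image f bij_betw_def inj_onD)
  moreover have "?g ` carrier L = {U. openin X U}"
  proof (intro Set.set_eqI iffI)
    fix U assume "U \<in> ?g ` carrier L"
    then show "U \<in> {U. openin X U}"
      using pre_image f_open f_sub by (fastforce simp: open_X Q_def)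
  next
    fix U assume "U \<in> {U. openin X U}"
    then have "Q U"
      by (simp add: open_X)
    then have "pre U \<in> f ` carrier L"
      using f by (auto simp: Q_def bij_betw_def)
    then show "U \<in> ?g ` carrier L"
      using image_pre[OF \<open>Q U\<close>] by (metis imageE imageI)
  qed
  moreover have "a \<sqsubseteq>\<^bsub>L\<^esub> b \<longleftrightarrow> ?g a \<subseteq> ?g b"
    if "a \<in> carrier L" "b \<in> carrier L" for a b
  proof -
    have "f a \<subseteq> f b" if "?g a \<subseteq> ?g b"
      using that pre_image[OF \<open>a \<in> carrier L\<close>] pre_image[OF \<open>b \<in> carrier L\<close>]
      by (metis (mono_tags, lifting) mem_Collect_eq pre_def subset_eq)
    then show ?thesis
      using f_le[OF that] by blast
  qed
  ultimately show ?thesis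
    unfolding spatial_def order_isomorphic_def open_set_frame_def
    by (intro exI[of _ X] exI[of _ ?g]) (auto simp: bij_betw_def)
qed

lemma partial_order_upset_frame: "partial_order (upset_frame S)"
  by unfold_locales (auto simp: upset_frame_def)

lemma meet_upset_frame:
  assumes "upset S U" "upset S V"
  shows "U \<sqinter>\<^bsub>upset_frame S\<^esub> V = U \<inter> V"
proof -
  interpret partial_order "upset_frame S"
    by (rule partial_order_upset_frame)
  have "upset S (U \<inter> V)"
    using assms by (auto simp: upset_def)
  with assms have "greatest (upset_frame S) (U \<inter> V) (Lower (upset_frame S) {U, V})"
    by (auto simp: greatest_def Lower_def upset_frame_def)
  then show ?thesis
    unfolding meet_def inf_def by (metis greatest_unique someI)
qed

end

theory Submission
  imports Defs
begin

text \<open>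
  The meet-prime upsets of \<open>S\<close> are the complements of the ideals of \<open>S\<close> (the nonempty directed
  downsets), and the frame of nuclei is spatial iff, for every nucleus \<open>j\<close>, each fixed upset of \<open>j\<close>
  is an intersection of fixed meet-prime upsets.

  Let \<open>B\<close> be fixed by \<open>j\<close>, let \<open>C\<close> be its complement and \<open>x \<in> C\<close>. If the elements of \<open>C\<close> above some
  \<open>y \<ge> x\<close> are directed in \<open>C\<close>, then the complement of the ideal which they generate is fixed by \<open>j\<close>
  and separates \<open>x\<close> from \<open>B\<close>. If there is no such \<open>y\<close>, then every element of \<open>C\<close> above \<open>x\<close> has two
  upper bounds in \<open>C\<close> which are incompatible in \<open>C\<close>, and iterating this choice embeds the binary tree.

  Conversely, if \<open>A\<close> is a copy of the binary tree in \<open>S\<close>, double negation on the upsets of \<open>A\<close>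
  induces a proper nucleus on the upsets of \<open>S\<close>. The complement of an ideal fixed by it would yield
  a node of \<open>A\<close> whose two successors have a common upper bound in \<open>A\<close>.
\<close>

section \<open>Points of a spatial frame as prime elements\<close>

text \<open>A point of the space lying in the open set of \<open>k\<close> but not in that of
  \<open>j\<close> yields \<open>m\<close> as the largest open set missing it. The last clause is
  meet-primeness of \<open>m\<close>, phrased with a common lower bound \<open>c\<close> so that no
  meet operation on \<open>L\<close> is involved.\<close>

lemma spatial_separating_prime:
  assumes "spatial L" and j: "j \<in> carrier L" and k: "k \<in> carrier L" "\<not> k \<sqsubseteq>\<^bsub>L\<^esub> j"
  obtains m where "m \<in> carrier L" "j \<sqsubseteq>\<^bsub>L\<^esub> m" "\<not> k \<sqsubseteq>\<^bsub>L\<^esub> m"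
    and "\<And>a b. \<lbrakk>a \<in> carrier L; b \<in> carrier L; \<not> a \<sqsubseteq>\<^bsub>L\<^esub> m; \<not> b \<sqsubseteq>\<^bsub>L\<^esub> m\<rbrakk> \<Longrightarrow>
      \<exists>c\<in>carrier L. c \<sqsubseteq>\<^bsub>L\<^esub> a \<and> c \<sqsubseteq>\<^bsub>L\<^esub> b \<and> \<not> c \<sqsubseteq>\<^bsub>L\<^esub> m"
proof -
  obtain X and g :: "'a \<Rightarrow> 'a set set" where g: "bij_betw g (carrier L) {U. openin X U}"
    and g_le: "\<And>a b. a \<in> carrier L \<Longrightarrow> b \<in> carrier L \<Longrightarrow> a \<sqsubseteq>\<^bsub>L\<^esub> b \<longleftrightarrow> g a \<subseteq> g b"
    using \<open>spatial L\<close> unfolding spatial_def order_isomorphic_def open_set_frame_def by auto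
  have g_open: "openin X (g a)" if "a \<in> carrier L" for a
    using g that by (auto simp: bij_betw_def)
  have g_surj: "\<exists>a\<in>carrier L. g a = U" if "openin X U" for U
    using g that unfolding bij_betw_def by (metis imageE mem_Collect_eq)
  obtain y where y: "y \<in> g k" "y \<notin> g j"
    using g_le[OF k(1) j] k(2) by blast
  have "openin X (\<Union>{U. openin X U \<and> y \<notin> U})"
    by (intro openin_Union) auto
  then obtain m where m: "m \<in> carrier L" "g m = \<Union>{U. openin X U \<and> y \<notin> U}"
    using g_surj by blast
  have le_m: "a \<sqsubseteq>\<^bsub>L\<^esub> m \<longleftrightarrow> y \<notin> g a" if "a \<in> carrier L" for a
    using g_le[OF that m(1)] g_open[OF that] m(2) by blast
  show thesis
  proof (rule that[OF m(1)])
    fix a b assume ab: "a \<in> carrier L" "b \<in> carrier L" "\<not> a \<sqsubseteq>\<^bsub>L\<^esub> m" "\<not> b \<sqsubseteq>\<^bsub>L\<^esub> m"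
    then obtain c where c: "c \<in> carrier L" "g c = g a \<inter> g b"
      using g_surj[of "g a \<inter> g b"] g_open by blast
    with ab show "\<exists>c\<in>carrier L. c \<sqsubseteq>\<^bsub>L\<^esub> a \<and> c \<sqsubseteq>\<^bsub>L\<^esub> b \<and> \<not> c \<sqsubseteq>\<^bsub>L\<^esub> m"
      by (intro bexI[of _ c]) (auto simp: le_m g_le)
  qed (use j k y le_m in auto)
qed

section \<open>Upsets, ideals and nuclei of a poset\<close>

locale poset = partial_order S for S :: "'a gorder" (structure)
begin

definition order_ideal :: "'a set \<Rightarrow> bool" where
  "order_ideal D \<longleftrightarrow> D \<subseteq> carrier S \<and> D \<noteq> {} \<and>
     (\<forall>x\<in>D. \<forall>y\<in>carrier S. y \<sqsubseteq> x \<longrightarrow> y \<in> D) \<and>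
     (\<forall>x\<in>D. \<forall>y\<in>D. \<exists>z\<in>D. x \<sqsubseteq> z \<and> y \<sqsubseteq> z)"

definition principal_upset :: "'a \<Rightarrow> 'a set" where
  "principal_upset x = {y \<in> carrier S. x \<sqsubseteq> y}"

abbreviation nuclei :: "('a set \<Rightarrow> 'a set) gorder" where
  "nuclei \<equiv> nuclei_frame (upset_frame S)"

lemma upset_Int: "upset S U \<Longrightarrow> upset S V \<Longrightarrow> upset S (U \<inter> V)"
  by (auto simp: upset_def)

lemma upset_carrier: "upset S (carrier S)"
  by (simp add: upset_def)

lemma upset_principal: "x \<in> carrier S \<Longrightarrow> upset S (principal_upset x)"
  by (auto simp: upset_def principal_upset_def) (meson le_trans)

lemma upset_compl_ideal: "order_ideal D \<Longrightarrow> upset S (carrier S - D)"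
  by (auto simp: upset_def order_ideal_def)

text \<open>If \<open>D\<close> meets both \<open>U\<close> and \<open>V\<close>, directedness gives
  an upper bound in \<open>D\<close> of the two witnesses, and it lies in both upsets.\<close>

lemma ideal_compl_prime:
  assumes "order_ideal D" "upset S U" "upset S V" "U \<inter> V \<subseteq> carrier S - D"
  shows "U \<subseteq> carrier S - D \<or> V \<subseteq> carrier S - D"
proof (rule ccontr)
  assume "\<not> ?thesis"
  then obtain x y where "x \<in> U" "x \<in> D" "y \<in> V" "y \<in> D"
    using assms(2,3) by (auto simp: upset_def)
  then obtain z where "z \<in> D" "z \<in> carrier S" "x \<sqsubseteq> z" "y \<sqsubseteq> z"
    using assms(1) unfolding order_ideal_def by (meson subsetD)
  then have "z \<in> U" "z \<in> V"
    using assms(2,3) \<open>x \<in> U\<close> \<open>y \<in> V\<close> by (auto simp: upset_def)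
  then show False
    using assms(4) \<open>z \<in> D\<close> by blast
qed

lemma nucleus_upset_frame_iff:
  "nucleus (upset_frame S) j \<longleftrightarrow>
     (\<forall>U. upset S U \<longrightarrow> upset S (j U)) \<and> (\<forall>U. upset S U \<longrightarrow> U \<subseteq> j U) \<and>
     (\<forall>U. upset S U \<longrightarrow> j (j U) = j U) \<and>
     (\<forall>U. upset S U \<longrightarrow> (\<forall>V. upset S V \<longrightarrow> j (U \<inter> V) = j U \<inter> j V))"
proof -
  have "carrier (upset_frame S) = {U. upset S U}" "U \<sqsubseteq>\<^bsub>upset_frame S\<^esub> V \<longleftrightarrow> U \<subseteq> V" for U V
    by (simp_all add: upset_frame_def)
  then show ?thesis
    by (simp add: nucleus_def Pi_iff meet_upset_frame cong: conj_cong)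
qed

lemma nucleus_upset: "nucleus (upset_frame S) j \<Longrightarrow> upset S U \<Longrightarrow> upset S (j U)"
  and nucleus_increasing: "nucleus (upset_frame S) j \<Longrightarrow> upset S U \<Longrightarrow> U \<subseteq> j U"
  and nucleus_idem: "nucleus (upset_frame S) j \<Longrightarrow> upset S U \<Longrightarrow> j (j U) = j U"
  and nucleus_Int:
    "nucleus (upset_frame S) j \<Longrightarrow> upset S U \<Longrightarrow> upset S V \<Longrightarrow> j (U \<inter> V) = j U \<inter> j V"
  by (simp_all add: nucleus_upset_frame_iff)

lemma nuclei_nucleus: "j \<in> carrier nuclei \<Longrightarrow> nucleus (upset_frame S) j"
  by (simp add: nuclei_frame_def)

lemma nuclei_le_iff: "j \<sqsubseteq>\<^bsub>nuclei\<^esub> k \<longleftrightarrow> (\<forall>U. upset S U \<longrightarrow> j U \<subseteq> k U)"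
  by (auto simp: nuclei_frame_def upset_frame_def)

lemma nuclei_eqI:
  assumes "j \<in> carrier nuclei" "k \<in> carrier nuclei" "\<And>U. upset S U \<Longrightarrow> j U = k U"
  shows "j = k"
  using assms by (auto simp: nuclei_frame_def upset_frame_def intro: extensionalityI)

lemma restrict_in_nuclei:
  assumes "nucleus (upset_frame S) j"
  shows "restrict j {U. upset S U} \<in> carrier nuclei"
proof -
  have "nucleus (upset_frame S) (restrict j {U. upset S U})"
    using assms unfolding nucleus_upset_frame_iff by (simp add: upset_Int)
  then show ?thesis
    by (auto simp: nuclei_frame_def upset_frame_def)
qed

lemma nucleus_mono:
  assumes "nucleus (upset_frame S) j" "upset S U" "upset S V" "U \<subseteq> V"
  shows "j U \<subseteq> j V"
  using nucleus_Int[OF assms(1-3)] \<open>U \<subseteq> V\<close> by (simp add: Int_absorb2 inf.absorb_iff1)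

lemma nucleus_le_fixed:
  assumes "nucleus (upset_frame S) j" "upset S U" "upset S V" "U \<subseteq> V" "j V = V"
  shows "j U \<subseteq> V"
  using nucleus_mono assms by metis

text \<open>The map sends \<open>U\<close> to the intersection of those complements of members of
  \<D> that contain \<open>U\<close>; primeness of the complements makes it preserve binary meets.
  Writing it as the complement of a union gives the value \<open>carrier S\<close> when no
  complement contains \<open>U\<close>.\<close>

lemma nucleus_of_primes:
  assumes "\<And>D. D \<in> \<D> \<Longrightarrow> order_ideal D"
  shows "nucleus (upset_frame S) (\<lambda>U. carrier S - \<Union>{D \<in> \<D>. U \<subseteq> carrier S - D})"
    (is "nucleus _ ?j")
  unfolding nucleus_upset_frame_iff
proof (intro conjI allI impI)
  fix U assume U: "upset S U"
  have "t \<in> ?j U" if "x \<in> ?j U" "t \<in> carrier S" "x \<sqsubseteq> t" for x t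
  proof -
    have "t \<notin> D" if D: "D \<in> \<D>" "U \<subseteq> carrier S - D" for D
      using assms[OF D(1)] D \<open>x \<in> ?j U\<close> \<open>x \<sqsubseteq> t\<close> unfolding order_ideal_def by blast
    with \<open>t \<in> carrier S\<close> show ?thesis
      by blast
  qed
  then show "upset S (?j U)"
    unfolding upset_def by blast
  have "U \<subseteq> carrier S"
    using U by (simp add: upset_def)
  then show "U \<subseteq> ?j U"
    by blast
  then show "?j (?j U) = ?j U"
    by blast
next
  fix U V assume UV: "upset S U" "upset S V"
  have "U \<inter> V \<subseteq> carrier S - D \<longleftrightarrow> U \<subseteq> carrier S - D \<or> V \<subseteq> carrier S - D" if "D \<in> \<D>" for D
    using ideal_compl_prime[OF assms[OF that] UV] by blast
  then show "?j (U \<inter> V) = ?j U \<inter> ?j V"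
    by blast
qed

section \<open>Nuclei as open sets of ideals\<close>

text \<open>The ideals whose complement \<open>j\<close> moves: as a point of the frame of nuclei, such an ideal lies
  in the open set given by \<open>j\<close>.\<close>

definition moved_ideals :: "('a set \<Rightarrow> 'a set) \<Rightarrow> 'a set set" where
  "moved_ideals j = {D. order_ideal D \<and> j (carrier S - D) \<noteq> carrier S - D}"

text \<open>The witness is the pointwise intersection of \<open>j\<close> and \<open>k\<close>. A
  prime \<open>P\<close> equals \<open>j P \<inter> k P\<close> only if \<open>j P\<close> or
  \<open>k P\<close> is contained in \<open>P\<close>, that is, only if \<open>j\<close> or
  \<open>k\<close> fixes \<open>P\<close>.\<close>

lemma moved_ideals_Int:
  assumes j: "j \<in> carrier nuclei" and k: "k \<in> carrier nuclei"
  shows "\<exists>m\<in>carrier nuclei. moved_ideals m = moved_ideals j \<inter> moved_ideals k"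
proof -
  let ?m = "\<lambda>U. j U \<inter> k U"
  note nuc = nuclei_nucleus[OF j] nuclei_nucleus[OF k]
  have "nucleus (upset_frame S) ?m"
    unfolding nucleus_upset_frame_iff
  proof (intro conjI allI impI)
    fix U assume U: "upset S U"
    show "upset S (?m U)"
      using nuc U by (simp add: upset_Int nucleus_upset)
    show "U \<subseteq> ?m U"
      using nuc U by (simp add: nucleus_increasing)
    show "?m (?m U) = ?m U"
      using nuc U nucleus_increasing[OF nuc(1) nucleus_upset[OF nuc(2) U]]
        nucleus_increasing[OF nuc(2) nucleus_upset[OF nuc(1) U]]
      by (simp add: nucleus_Int nucleus_upset nucleus_idem) blast
  next
    fix U V assume "upset S U" "upset S V"
    then show "?m (U \<inter> V) = ?m U \<inter> ?m V"
      using nuc by (simp add: nucleus_Int ac_simps)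
  qed
  then have "restrict ?m {U. upset S U} \<in> carrier nuclei"
    by (rule restrict_in_nuclei)
  moreover have "moved_ideals (restrict ?m {U. upset S U}) = moved_ideals j \<inter> moved_ideals k"
  proof -
    have "j P \<inter> k P = P \<longleftrightarrow> j P = P \<or> k P = P"
      if D: "order_ideal D" and P: "P = carrier S - D" for D P
    proof -
      have up: "upset S P"
        using upset_compl_ideal[OF D] P by simp
      then show ?thesis
        using ideal_compl_prime[OF D, of "j P" "k P"] nucleus_upset[OF _ up]
          nucleus_increasing[OF nuc(1) up] nucleus_increasing[OF nuc(2) up] nuc P
        by auto
    qed
    then show ?thesis
      unfolding moved_ideals_def by (simp add: upset_compl_ideal set_eq_iff cong: conj_cong)
  qed
  ultimately show ?thesis
    by blast
qed

text \<open>The witness is the nucleus induced by the primes that all of \<open>K\<close> fix. It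
  need not be the join of \<open>K\<close>, but it fixes the same primes: a prime fixed by it is an
  intersection of primes fixed by each \<open>j\<close> in \<open>K\<close>, hence itself fixed by
  \<open>j\<close>.\<close>

lemma moved_ideals_Union:
  assumes K: "K \<subseteq> carrier nuclei"
  shows "\<exists>m\<in>carrier nuclei. moved_ideals m = (\<Union>j\<in>K. moved_ideals j)"
proof -
  define \<D> where "\<D> = {D. order_ideal D \<and> (\<forall>j\<in>K. j (carrier S - D) = carrier S - D)}"
  let ?m = "\<lambda>U. carrier S - \<Union>{D \<in> \<D>. U \<subseteq> carrier S - D}"
  have "nucleus (upset_frame S) ?m"
    by (rule nucleus_of_primes) (simp add: \<D>_def)
  then have "restrict ?m {U. upset S U} \<in> carrier nuclei"
    by (rule restrict_in_nuclei)
  moreover have "?m (carrier S - D) = carrier S - D \<longleftrightarrow> D \<in> \<D>" if D: "order_ideal D" for D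
  proof
    assume fixed: "?m (carrier S - D) = carrier S - D"
    have "j (carrier S - D) = carrier S - D" if "j \<in> K" for j
    proof
      have nuc: "nucleus (upset_frame S) j"
        using that K nuclei_nucleus by blast
      then show "carrier S - D \<subseteq> j (carrier S - D)"
        using upset_compl_ideal[OF D] by (simp add: nucleus_upset_frame_iff)
      have "upset S (j (carrier S - D))"
        using nuc upset_compl_ideal[OF D] by (simp add: nucleus_upset_frame_iff)
      moreover have "j (carrier S - D) \<subseteq> carrier S - E"
        if "E \<in> \<D>" "carrier S - D \<subseteq> carrier S - E" for E
        using nucleus_le_fixed[OF nuc upset_compl_ideal[OF D] upset_compl_ideal] that \<open>j \<in> K\<close>
        by (simp add: \<D>_def)
      ultimately have "j (carrier S - D) \<subseteq> ?m (carrier S - D)"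
        unfolding upset_def by blast
      with fixed show "j (carrier S - D) \<subseteq> carrier S - D"
        by simp
    qed
    with D show "D \<in> \<D>"
      by (simp add: \<D>_def)
  next
    assume "D \<in> \<D>"
    then show "?m (carrier S - D) = carrier S - D"
      by blast
  qed
  then have "moved_ideals (restrict ?m {U. upset S U}) = (\<Union>j\<in>K. moved_ideals j)"
    unfolding moved_ideals_def \<D>_def
    by (simp add: upset_compl_ideal set_eq_iff cong: conj_cong)
  ultimately show ?thesis
    by blast
qed

text \<open>The sets \<open>moved_ideals j\<close> already form a topology on the ideals. The
  premise provides enough fixed primes for \<open>moved_ideals\<close> to reflect the order, which
  makes it an isomorphism onto that topology.\<close>

lemma spatial_nucleiI:
  assumes enough: "\<And>j U x. \<lbrakk>nucleus (upset_frame S) j; upset S U; x \<in> carrier S; x \<notin> j U\<rbrakk> \<Longrightarrow>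
    \<exists>D. order_ideal D \<and> x \<in> D \<and> U \<subseteq> carrier S - D \<and> j (carrier S - D) = carrier S - D"
  shows "spatial nuclei"
proof -
  define Q where "Q W \<longleftrightarrow> W \<in> moved_ideals ` carrier nuclei" for W
  have ist: "istopology Q"
    unfolding istopology_def
  proof (intro conjI allI impI)
    fix V W assume "Q V" "Q W"
    then obtain j k where jk: "j \<in> carrier nuclei" "V = moved_ideals j"
        "k \<in> carrier nuclei" "W = moved_ideals k"
      unfolding Q_def by (elim imageE)
    then show "Q (V \<inter> W)"
      using moved_ideals_Int[OF jk(1,3)] unfolding Q_def image_iff by metis
  next
    fix \<W> assume "\<forall>W\<in>\<W>. Q W"
    then have "\<W> \<subseteq> moved_ideals ` carrier nuclei"
      by (auto simp: Q_def)
    then obtain K where "K \<subseteq> carrier nuclei" "\<W> = moved_ideals ` K"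
      by (auto simp: subset_image_iff)
    then show "Q (\<Union>\<W>)"
      using moved_ideals_Union[of K] unfolding Q_def image_iff by metis
  qed
  have open_iff: "openin (topology Q) W \<longleftrightarrow> Q W" for W
    using ist by (simp add: topology_inverse')
  have le_iff: "j \<sqsubseteq>\<^bsub>nuclei\<^esub> k \<longleftrightarrow> moved_ideals j \<subseteq> moved_ideals k"
    if j: "j \<in> carrier nuclei" and k: "k \<in> carrier nuclei" for j k
  proof
    assume le: "j \<sqsubseteq>\<^bsub>nuclei\<^esub> k"
    have "j P = P" if "upset S P" "k P = P" for P
      using le that nucleus_increasing[OF nuclei_nucleus[OF j]]
      unfolding nuclei_le_iff by blast
    then show "moved_ideals j \<subseteq> moved_ideals k"
      using upset_compl_ideal by (auto simp: moved_ideals_def)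
  next
    assume sub: "moved_ideals j \<subseteq> moved_ideals k"
    show "j \<sqsubseteq>\<^bsub>nuclei\<^esub> k"
      unfolding nuclei_le_iff
    proof (intro allI impI subsetI)
      fix U x assume U: "upset S U" and x: "x \<in> j U"
      have nuc_j: "nucleus (upset_frame S) j"
        using j by (rule nuclei_nucleus)
      then have "x \<in> carrier S"
        using nucleus_upset[OF _ U] x by (auto simp: upset_def)
      \<comment> \<open>Otherwise some prime fixed by \<open>k\<close> contains \<open>U\<close> and
        misses \<open>x\<close>. By \<open>sub\<close>, \<open>j\<close> fixes it too, so it
        contains \<open>j U\<close>, although \<open>x\<close> is in \<open>j U\<close>.\<close>
      show "x \<in> k U"
      proof (rule ccontr)
        assume "x \<notin> k U"
        then obtain D where D: "order_ideal D" "x \<in> D" "U \<subseteq> carrier S - D"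
            "k (carrier S - D) = carrier S - D"
          using enough[OF nuclei_nucleus[OF k] U \<open>x \<in> carrier S\<close>] by blast
        then have "j (carrier S - D) = carrier S - D"
          using sub by (auto simp: moved_ideals_def)
        then have "j U \<subseteq> carrier S - D"
          using nucleus_le_fixed[OF nuc_j U upset_compl_ideal] D by blast
        with x D show False
          by blast
      qed
    qed
  qed
  have "inj_on moved_ideals (carrier nuclei)"
  proof (rule inj_onI)
    fix j k assume jk: "j \<in> carrier nuclei" "k \<in> carrier nuclei" "moved_ideals j = moved_ideals k"
    then have "j \<sqsubseteq>\<^bsub>nuclei\<^esub> k" "k \<sqsubseteq>\<^bsub>nuclei\<^esub> j"
      by (auto simp: le_iff)
    then show "j = k"
      using nuclei_eqI[OF jk(1,2)] unfolding nuclei_le_iff by blast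
  qed
  then have "order_isomorphic nuclei (open_set_frame (topology Q))"
    unfolding order_isomorphic_def
    by (intro exI[of _ moved_ideals])
       (auto simp: open_set_frame_def open_iff Q_def le_iff bij_betw_def)
  then show ?thesis
    by (rule spatial_if_order_isomorphic)
qed

section \<open>Fixed primes from spatiality\<close>

text \<open>A prime nucleus \<open>m\<close> above \<open>j\<close> is pulled back to a prime upset
  along the embedding of upsets as closed nuclei \<open>A \<union> _\<close>. The hypothesis on
  \<open>U\<close> says that \<open>j\<close> is not the top nucleus, so such an \<open>m\<close>
  can be chosen different from the top.\<close>

lemma spatial_nuclei_fixed_prime:
  assumes "spatial nuclei" and j: "j \<in> carrier nuclei" and U: "upset S U" "j U \<noteq> carrier S"
  obtains D where "order_ideal D" "j (carrier S - D) = carrier S - D"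
proof -
  define closed_nucleus where "closed_nucleus A = (\<lambda>U\<in>{U. upset S U}. A \<union> U)" for A
  have closed: "closed_nucleus A \<in> carrier nuclei" if "upset S A" for A
    unfolding closed_nucleus_def using that
    by (intro restrict_in_nuclei) (auto simp: nucleus_upset_frame_iff upset_def)
  have closed_apply: "closed_nucleus A U = A \<union> U" if "upset S U" for A U
    using that by (simp add: closed_nucleus_def)
  have upset_empty: "upset S {}"
    by (simp add: upset_def)
  have "\<not> closed_nucleus (carrier S) \<sqsubseteq>\<^bsub>nuclei\<^esub> j"
  proof
    assume "closed_nucleus (carrier S) \<sqsubseteq>\<^bsub>nuclei\<^esub> j"
    then have "carrier S \<union> U \<subseteq> j U"
      using U(1) closed_apply unfolding nuclei_le_iff by metis
    moreover have "j U \<subseteq> carrier S"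
      using nucleus_upset[OF nuclei_nucleus[OF j] U(1)] by (simp add: upset_def)
    ultimately show False
      using U(2) by blast
  qed
  from spatial_separating_prime[OF \<open>spatial nuclei\<close> j closed[OF upset_carrier] this]
  obtain m where m: "m \<in> carrier nuclei" "j \<sqsubseteq>\<^bsub>nuclei\<^esub> m"
      "\<not> closed_nucleus (carrier S) \<sqsubseteq>\<^bsub>nuclei\<^esub> m"
    and prime: "\<And>a b. \<lbrakk>a \<in> carrier nuclei; b \<in> carrier nuclei;
        \<not> a \<sqsubseteq>\<^bsub>nuclei\<^esub> m; \<not> b \<sqsubseteq>\<^bsub>nuclei\<^esub> m\<rbrakk> \<Longrightarrow>
      \<exists>c\<in>carrier nuclei. c \<sqsubseteq>\<^bsub>nuclei\<^esub> a \<and> c \<sqsubseteq>\<^bsub>nuclei\<^esub> b \<and> \<not> c \<sqsubseteq>\<^bsub>nuclei\<^esub> m"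
    by metis
  have nuc_m: "nucleus (upset_frame S) m"
    using m(1) by (rule nuclei_nucleus)
  \<comment> \<open>\<open>P\<close> is the largest upset whose closed nucleus lies below
    \<open>m\<close>, as \<open>closed_le\<close> shows; it is also fixed by \<open>m\<close>, and
    hence by \<open>j\<close>.\<close>
  define P where "P = m {}"
  have P: "upset S P" "m P = P"
    using nuc_m upset_empty by (auto simp: P_def nucleus_upset_frame_iff)
  have closed_le: "closed_nucleus A \<sqsubseteq>\<^bsub>nuclei\<^esub> m \<longleftrightarrow> A \<subseteq> P" if A: "upset S A" for A
  proof
    assume "closed_nucleus A \<sqsubseteq>\<^bsub>nuclei\<^esub> m"
    then show "A \<subseteq> P"
      using upset_empty closed_apply unfolding nuclei_le_iff P_def by fastforce
  next
    assume "A \<subseteq> P"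
    moreover have "P \<subseteq> m U" "U \<subseteq> m U" if "upset S U" for U
      using nucleus_mono[OF nuc_m upset_empty that] nuc_m that
      by (auto simp: P_def nucleus_upset_frame_iff)
    ultimately show "closed_nucleus A \<sqsubseteq>\<^bsub>nuclei\<^esub> m"
      unfolding nuclei_le_iff using closed_apply by blast
  qed
  have prime_P: "\<not> A \<inter> B \<subseteq> P"
    if A: "upset S A" "\<not> A \<subseteq> P" and B: "upset S B" "\<not> B \<subseteq> P" for A B
  proof
    assume "A \<inter> B \<subseteq> P"
    obtain c where c: "c \<sqsubseteq>\<^bsub>nuclei\<^esub> closed_nucleus A" "c \<sqsubseteq>\<^bsub>nuclei\<^esub> closed_nucleus B"
        "\<not> c \<sqsubseteq>\<^bsub>nuclei\<^esub> m"
      using prime[OF closed[OF A(1)] closed[OF B(1)]] A B by (auto simp: closed_le)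
    \<comment> \<open>At \<open>U\<close>, the nucleus \<open>c\<close> is bounded by \<open>(A
      \<union> U) \<inter> (B \<union> U) = (A \<inter> B) \<union> U\<close>.\<close>
    from c(1,2) have "c \<sqsubseteq>\<^bsub>nuclei\<^esub> closed_nucleus (A \<inter> B)"
      unfolding nuclei_le_iff by (simp add: closed_apply) blast
    moreover have "closed_nucleus (A \<inter> B) \<sqsubseteq>\<^bsub>nuclei\<^esub> m"
      using closed_le[OF upset_Int[OF A(1) B(1)]] \<open>A \<inter> B \<subseteq> P\<close> by simp
    ultimately show False
      using c(3) unfolding nuclei_le_iff by blast
  qed
  have "order_ideal (carrier S - P)"
    unfolding order_ideal_def
  proof (intro conjI ballI impI)
    show "carrier S - P \<noteq> {}"
      using m(3) closed_le[OF upset_carrier] by blast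
  next
    \<comment> \<open>Directedness of the complement is primeness of \<open>P\<close> applied to
      principal upsets.\<close>
    fix x y assume "x \<in> carrier S - P" "y \<in> carrier S - P"
    then have "\<not> principal_upset x \<inter> principal_upset y \<subseteq> P"
      by (intro prime_P upset_principal) (auto simp: principal_upset_def)
    then show "\<exists>z\<in>carrier S - P. x \<sqsubseteq> z \<and> y \<sqsubseteq> z"
      by (auto simp: principal_upset_def)
  qed (use P in \<open>auto simp: upset_def\<close>)
  moreover have "carrier S - (carrier S - P) = P"
    using P by (auto simp: upset_def)
  moreover have "j P = P"
    using m(2) P nucleus_increasing[OF nuclei_nucleus[OF j]]
    unfolding nuclei_le_iff by blast
  ultimately show thesis
    using that[of "carrier S - P"] by simp
qed

section \<open>Branching, binary trees and directedness\<close>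

text \<open>Iterated choice of two incompatible elements maps sequences into \<open>C\<close>.
  Incompatibility makes the map reflect the order: if \<open>h s \<sqsubseteq> h t\<close> without
  \<open>s\<close> being a prefix of \<open>t\<close>, two siblings acquire an upper bound in
  \<open>C\<close>.\<close>

lemma binary_tree_embeds_if_branching:
  assumes C: "C \<subseteq> carrier S" "r \<in> C"
    and branch: "\<And>x. x \<in> C \<Longrightarrow> \<exists>y\<in>C. \<exists>z\<in>C. x \<sqsubseteq> y \<and> x \<sqsubseteq> z \<and> \<not> (\<exists>w\<in>C. y \<sqsubseteq> w \<and> z \<sqsubseteq> w)"
  shows "\<exists>A \<subseteq> carrier S. order_isomorphic binary_tree (subposet S A)"
proof -
  obtain y z where yz: "\<And>x. x \<in> C \<Longrightarrow> y x \<in> C \<and> z x \<in> C \<and> x \<sqsubseteq> y x \<and> x \<sqsubseteq> z x \<and>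
      \<not> (\<exists>w\<in>C. y x \<sqsubseteq> w \<and> z x \<sqsubseteq> w)"
    using branch by metis
  define h where "h = foldl (\<lambda>x b. if b then y x else z x) r"
  have h_snoc: "h (s @ [b]) = (if b then y (h s) else z (h s))" for s b
    by (simp add: h_def)
  have hC: "h s \<in> C" for s
  proof (induction s rule: rev_induct)
    case Nil
    then show ?case
      using C by (simp add: h_def)
  next
    case (snoc b s)
    then show ?case
      using yz by (simp add: h_snoc)
  qed
  note h_carrier = subsetD[OF C(1) hC]
  have h_step: "h s \<sqsubseteq> h (s @ [b])" for s b
    using yz[OF hC] by (simp add: h_snoc)
  have h_append: "h s \<sqsubseteq> h (s @ t)" for s t
  proof (induction t rule: rev_induct)
    case Nil
    then show ?case
      using h_carrier by simp
  next
    case (snoc b t)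
    then show ?case
      using le_trans[OF _ h_step[of "s @ t" b]] h_carrier by simp
  qed
  have incompatible: False if "w \<in> C" "h (s @ [b]) \<sqsubseteq> w" "h (s @ [c]) \<sqsubseteq> w" "b \<noteq> c" for s b c w
    using yz[OF hC, of s] that by (cases b; cases c) (auto simp: h_snoc)
  have h_le_iff: "h s \<sqsubseteq> h t \<longleftrightarrow> prefix s t" for s t
  proof
    assume "prefix s t"
    then show "h s \<sqsubseteq> h t"
      using h_append by (auto simp: prefix_def)
  next
    assume le: "h s \<sqsubseteq> h t"
    show "prefix s t"
    proof (rule ccontr)
      assume "\<not> prefix s t"
      then consider "strict_prefix t s" | "s \<parallel> t"
        by (metis parallelI strict_prefixI prefix_order.refl)
      \<comment> \<open>\<open>u\<close> is the node where the branches part. If \<open>t\<close> is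
        a proper prefix of \<open>s\<close>, then \<open>u = t\<close>, and \<open>t\<close> is
        prolonged by the letter that \<open>s\<close> does not take; so \<open>h (t @ cs)\<close>
        bounds both children of \<open>u\<close>.\<close>
      then obtain u b bs c cs where u: "s = u @ b # bs" "b \<noteq> c" "h (u @ [c]) \<sqsubseteq> h (t @ cs)"
      proof cases
        case 1
        then obtain b bs where "s = t @ b # bs"
          by (auto elim: strict_prefixE')
        then show thesis
          using that[of t b bs "\<not> b" "[\<not> b]"] h_carrier by simp
      next
        case 2
        then obtain u b bs c cs where "b \<noteq> c" "s = u @ b # bs" "t = u @ c # cs"
          using parallel_decomp[OF 2] by blast
        then show thesis
          using that[of u b bs c "[]"] h_append[of "u @ [c]" cs] by simp
      qed
      have "h (u @ [b]) \<sqsubseteq> h s"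
        using h_append[of "u @ [b]" bs] u(1) by simp
      then have "h (u @ [b]) \<sqsubseteq> h (t @ cs)"
        using le h_append[of t cs] h_carrier by (meson le_trans)
      then show False
        using incompatible hC u by blast
    qed
  qed
  have "inj h"
    by (rule injI) (metis h_le_iff h_carrier le_refl prefix_order.antisym)
  then have "order_isomorphic binary_tree (subposet S (range h))"
    unfolding order_isomorphic_def binary_tree_def subposet_def
    by (intro exI[of _ h]) (auto simp: bij_betw_def h_le_iff)
  then show ?thesis
    using h_carrier by blast
qed

text \<open>\<open>D\<close> is the ideal generated by the elements above \<open>y\<close> outside
  \<open>B\<close>. A point of \<open>D\<close> in \<open>j (carrier S - D)\<close> would lie below
  a generator \<open>u\<close>; localising to the principal upset of \<open>u\<close> replaces the
  complement of \<open>D\<close> by a part of \<open>B\<close>, and \<open>j B = B\<close> forces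
  \<open>u\<close> into \<open>B\<close>.\<close>

lemma fixed_prime_if_directed:
  assumes nuc: "nucleus (upset_frame S) j" and B: "upset S B" "j B = B"
    and y: "y \<in> carrier S" "y \<notin> B"
    and directed: "\<And>u v. \<lbrakk>u \<in> carrier S - B; v \<in> carrier S - B; y \<sqsubseteq> u; y \<sqsubseteq> v\<rbrakk> \<Longrightarrow>
      \<exists>w\<in>carrier S - B. u \<sqsubseteq> w \<and> v \<sqsubseteq> w"
  obtains D where "order_ideal D" "y \<in> D" "B \<subseteq> carrier S - D" "j (carrier S - D) = carrier S - D"
proof -
  define D where "D = {x \<in> carrier S. \<exists>u\<in>carrier S - B. x \<sqsubseteq> u \<and> y \<sqsubseteq> u}"
  have "y \<in> D"
    using y by (auto simp: D_def)
  have D: "order_ideal D"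
    unfolding order_ideal_def
  proof (intro conjI ballI impI)
    fix a b assume "a \<in> D" "b \<in> D"
    then obtain u v where uv: "a \<in> carrier S" "u \<in> carrier S - B" "a \<sqsubseteq> u" "y \<sqsubseteq> u"
        "b \<in> carrier S" "v \<in> carrier S - B" "b \<sqsubseteq> v" "y \<sqsubseteq> v"
      by (auto simp: D_def)
    then obtain w where "w \<in> carrier S - B" "u \<sqsubseteq> w" "v \<sqsubseteq> w"
      using directed by blast
    then have w: "w \<in> carrier S - B" "a \<sqsubseteq> w" "b \<sqsubseteq> w" "y \<sqsubseteq> w"
      using uv y by (meson le_trans DiffD1)+
    then have "w \<in> D"
      by (auto simp: D_def)
    with w show "\<exists>z\<in>D. a \<sqsubseteq> z \<and> b \<sqsubseteq> z"
      by blast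
  next
    fix a b assume "a \<in> D" "b \<in> carrier S" "b \<sqsubseteq> a"
    then show "b \<in> D"
      unfolding D_def by (auto intro: le_trans[of b a])
  qed (use \<open>y \<in> D\<close> in \<open>auto simp: D_def\<close>)
  have up: "upset S (carrier S - D)"
    using D by (rule upset_compl_ideal)
  have BD: "B \<subseteq> carrier S - D"
    using B(1) by (auto simp: D_def upset_def)
  have "j (carrier S - D) \<subseteq> carrier S - D"
  proof
    fix x assume x: "x \<in> j (carrier S - D)"
    have up_j: "upset S (j (carrier S - D))"
      using nuc up by (simp add: nucleus_upset_frame_iff)
    then have "x \<in> carrier S"
      using x by (auto simp: upset_def)
    moreover have "x \<notin> D"
    proof
      assume "x \<in> D"
      then obtain u where u: "u \<in> carrier S" "u \<notin> B" "x \<sqsubseteq> u" "y \<sqsubseteq> u"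
        by (auto simp: D_def)
      text \<open>Above \<open>u\<close> the complement of \<open>D\<close> coincides with \<open>B\<close>.\<close>
      have "(carrier S - D) \<inter> principal_upset u \<subseteq> B"
        using u y by (auto simp: D_def principal_upset_def intro: le_trans[of y u])
      then have "j ((carrier S - D) \<inter> principal_upset u) \<subseteq> B"
        using nucleus_le_fixed[OF nuc upset_Int] up upset_principal u B by blast
      moreover have "u \<in> j (carrier S - D)"
        using up_j x u by (auto simp: upset_def)
      moreover have "u \<in> j (principal_upset u)"
        using nuc upset_principal[OF u(1)] u(1)
          nucleus_increasing by (auto simp: principal_upset_def)
      ultimately show False
        using nucleus_Int[OF nuc up upset_principal[OF u(1)]] u(2) by blast
    qed
    ultimately show "x \<in> carrier S - D"
      by blast
  qed
  moreover have "carrier S - D \<subseteq> j (carrier S - D)"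
    using nuc up by (simp add: nucleus_upset_frame_iff)
  ultimately show thesis
    using that D \<open>y \<in> D\<close> BD by blast
qed

lemma spatial_nuclei_if_no_binary_tree:
  assumes no_tree: "\<not> (\<exists>A \<subseteq> carrier S. order_isomorphic binary_tree (subposet S A))"
  shows "spatial nuclei"
proof (rule spatial_nucleiI)
  fix j U x
  assume nuc: "nucleus (upset_frame S) j" and U: "upset S U" and x: "x \<in> carrier S" "x \<notin> j U"
  \<comment> \<open>Restricting to elements above \<open>x\<close> ensures that the non-branching
    \<open>y\<close> found in \<open>C\<close> is above \<open>x\<close>, so any ideal containing
    \<open>y\<close> contains \<open>x\<close>.\<close>
  define C where "C = {y \<in> carrier S - j U. x \<sqsubseteq> y}"
  have jU: "upset S (j U)" "j (j U) = j U" "U \<subseteq> j U"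
    using nuc U by (auto simp: nucleus_upset_frame_iff)
  have "C \<subseteq> carrier S" "x \<in> C"
    using x by (auto simp: C_def)
  then obtain y where y: "y \<in> C"
    and no_branch: "\<not> (\<exists>u\<in>C. \<exists>v\<in>C. y \<sqsubseteq> u \<and> y \<sqsubseteq> v \<and> \<not> (\<exists>w\<in>C. u \<sqsubseteq> w \<and> v \<sqsubseteq> w))"
    using binary_tree_embeds_if_branching[of C x] no_tree by blast
  have above_y: "u \<in> C" if "u \<in> carrier S - j U" "y \<sqsubseteq> u" for u
    using y that x by (auto simp: C_def) (meson le_trans)
  obtain D where D: "order_ideal D" "y \<in> D" "j U \<subseteq> carrier S - D"
      "j (carrier S - D) = carrier S - D"
  proof (rule fixed_prime_if_directed[OF nuc jU(1,2)])
    show "y \<in> carrier S" "y \<notin> j U"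
      using y by (auto simp: C_def)
  next
    fix u v assume "u \<in> carrier S - j U" "v \<in> carrier S - j U" "y \<sqsubseteq> u" "y \<sqsubseteq> v"
    then obtain w where "w \<in> C" "u \<sqsubseteq> w" "v \<sqsubseteq> w"
      using no_branch above_y by blast
    then show "\<exists>w\<in>carrier S - j U. u \<sqsubseteq> w \<and> v \<sqsubseteq> w"
      by (auto simp: C_def)
  qed
  moreover have "x \<in> D"
    using D(1,2) x y by (auto simp: order_ideal_def C_def)
  ultimately show "\<exists>D. order_ideal D \<and> x \<in> D \<and> U \<subseteq> carrier S - D \<and>
      j (carrier S - D) = carrier S - D"
    using jU(3) by blast
qed

section \<open>The nucleus of a binary tree\<close>

text \<open>Double negation on the upsets of \<open>A\<close>, transported to the upsets of \<open>S\<close>.\<close>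

definition dense_nucleus :: "'a set \<Rightarrow> 'a set \<Rightarrow> 'a set" where
  "dense_nucleus A U = {x \<in> carrier S. \<forall>a\<in>A. x \<sqsubseteq> a \<longrightarrow> (\<exists>b\<in>A. a \<sqsubseteq> b \<and> b \<in> U)}"

text \<open>Membership of \<open>x\<close> means that \<open>U\<close> is cofinal in the part of
  \<open>A\<close> above \<open>x\<close>. Idempotence composes two extensions; for meets, an
  extension into \<open>U\<close> is followed by one into \<open>V\<close>, which stays in the upset
  \<open>U\<close>.\<close>

lemma nucleus_dense_nucleus:
  assumes A: "A \<subseteq> carrier S"
  shows "nucleus (upset_frame S) (dense_nucleus A)"
  unfolding nucleus_upset_frame_iff
proof (intro conjI allI impI)
  fix U assume U: "upset S U"
  show "upset S (dense_nucleus A U)"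
    using A by (auto simp: upset_def dense_nucleus_def) (meson le_trans subsetD)
  show sub: "U \<subseteq> dense_nucleus A U" if "upset S U" for U
  proof
    fix x assume "x \<in> U"
    moreover have "a \<in> U \<and> a \<sqsubseteq> a" if "a \<in> A" "x \<sqsubseteq> a" for a
      using that A \<open>x \<in> U\<close> \<open>upset S U\<close> unfolding upset_def by blast
    ultimately show "x \<in> dense_nucleus A U"
      using \<open>upset S U\<close> unfolding dense_nucleus_def upset_def by blast
  qed
  show "dense_nucleus A (dense_nucleus A U) = dense_nucleus A U"
  proof
    show "dense_nucleus A U \<subseteq> dense_nucleus A (dense_nucleus A U)"
      using sub \<open>upset S (dense_nucleus A U)\<close> by blast
    show "dense_nucleus A (dense_nucleus A U) \<subseteq> dense_nucleus A U"
    proof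
      fix x assume x: "x \<in> dense_nucleus A (dense_nucleus A U)"
      have "\<exists>c\<in>A. a \<sqsubseteq> c \<and> c \<in> U" if a: "a \<in> A" "x \<sqsubseteq> a" for a
      proof -
        obtain b where b: "b \<in> A" "a \<sqsubseteq> b" "b \<in> dense_nucleus A U"
          using x a by (auto simp: dense_nucleus_def)
        then obtain c where "c \<in> A" "b \<sqsubseteq> c" "c \<in> U"
          using A by (auto simp: dense_nucleus_def)
        then show ?thesis
          using a b A by (meson le_trans subsetD)
      qed
      then show "x \<in> dense_nucleus A U"
        using x by (auto simp: dense_nucleus_def)
    qed
  qed
next
  fix U V assume UV: "upset S U" "upset S V"
  show "dense_nucleus A (U \<inter> V) = dense_nucleus A U \<inter> dense_nucleus A V"
  proof
    show "dense_nucleus A U \<inter> dense_nucleus A V \<subseteq> dense_nucleus A (U \<inter> V)"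
    proof
      fix x assume x: "x \<in> dense_nucleus A U \<inter> dense_nucleus A V"
      then have "x \<in> carrier S"
        by (simp add: dense_nucleus_def)
      moreover have "\<exists>c\<in>A. a \<sqsubseteq> c \<and> c \<in> U \<inter> V" if a: "a \<in> A" "x \<sqsubseteq> a" for a
      proof -
        obtain b where b: "b \<in> A" "a \<sqsubseteq> b" "b \<in> U"
          using x a by (auto simp: dense_nucleus_def)
        then have "x \<sqsubseteq> b"
          using \<open>x \<in> carrier S\<close> a A by (meson le_trans subsetD)
        then obtain c where c: "c \<in> A" "b \<sqsubseteq> c" "c \<in> V"
          using x b by (auto simp: dense_nucleus_def)
        then have "c \<in> U" "a \<sqsubseteq> c"
          using UV a b A unfolding upset_def by (meson le_trans subsetD)+
        with c show ?thesis
          by blast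
      qed
      ultimately show "x \<in> dense_nucleus A (U \<inter> V)"
        by (auto simp: dense_nucleus_def)
    qed
  qed (auto simp: dense_nucleus_def)
qed

lemma not_spatial_nuclei_if_binary_tree:
  assumes A: "A \<subseteq> carrier S" "order_isomorphic binary_tree (subposet S A)"
  shows "\<not> spatial nuclei"
proof
  assume spatial: "spatial nuclei"
  obtain f :: "bool list \<Rightarrow> 'a" where f: "range f = A" and f_le: "\<And>s t. f s \<sqsubseteq> f t \<longleftrightarrow> prefix s t"
    using A(2) by (auto simp: order_isomorphic_def binary_tree_def subposet_def bij_betw_def)
  define j where "j = restrict (dense_nucleus A) {U. upset S U}"
  have "j \<in> carrier nuclei"
    unfolding j_def using nucleus_dense_nucleus[OF A(1)] by (rule restrict_in_nuclei)
  moreover have "upset S {}" "j {} \<noteq> carrier S"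
  proof -
    show "upset S {}"
      by (simp add: upset_def)
    \<comment> \<open>No extension enters the empty upset, so an element of \<open>A\<close>, such
      as the root, is outside its image and \<open>j\<close> is not the top nucleus.\<close>
    moreover have "f [] \<in> A" "f [] \<sqsubseteq> f []"
      using f f_le by auto
    then have "f [] \<in> carrier S - dense_nucleus A {}"
      using A(1) by (auto simp: dense_nucleus_def)
    ultimately show "j {} \<noteq> carrier S"
      by (auto simp: j_def)
  qed
  ultimately obtain D where D: "order_ideal D" "j (carrier S - D) = carrier S - D"
    using spatial_nuclei_fixed_prime[OF spatial] by blast
  then have fixed: "dense_nucleus A (carrier S - D) = carrier S - D"
    by (simp add: j_def upset_compl_ideal)
  have D_carrier: "D \<subseteq> carrier S"
    using D(1) by (simp add: order_ideal_def)
  \<comment> \<open>Negating membership in \<open>dense_nucleus A (carrier S - D)\<close> gives a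
    node above \<open>x\<close> all of whose extensions in the tree avoid
    \<open>carrier S - D\<close>.\<close>
  have cofinal: "\<exists>s. x \<sqsubseteq> f s \<and> (\<forall>t. prefix s t \<longrightarrow> f t \<in> D)" if "x \<in> D" for x
  proof -
    have "x \<in> carrier S" "x \<notin> dense_nucleus A (carrier S - D)"
      using fixed that D_carrier by auto
    then obtain a where "a \<in> A" "x \<sqsubseteq> a" "\<forall>b\<in>A. a \<sqsubseteq> b \<longrightarrow> b \<in> D"
      using A(1) by (auto simp: dense_nucleus_def)
    then show ?thesis
      using f f_le by blast
  qed
  obtain x where "x \<in> D"
    using D(1) by (auto simp: order_ideal_def)
  then obtain s where "\<forall>t. prefix s t \<longrightarrow> f t \<in> D"
    using cofinal by blast
  then have "f (s @ [b]) \<in> D" for b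
    by simp
  \<comment> \<open>Directedness bounds the two children of \<open>s\<close> by some
    \<open>z\<close> in \<open>D\<close>, perhaps outside the tree; \<open>cofinal\<close> then
    moves this bound to a node \<open>f t\<close>, which cannot extend both children.\<close>
  then obtain z where z: "z \<in> D" "f (s @ [True]) \<sqsubseteq> z" "f (s @ [False]) \<sqsubseteq> z"
    using D(1) unfolding order_ideal_def by meson
  then obtain t where t: "z \<sqsubseteq> f t"
    using cofinal by blast
  have "f u \<in> carrier S" for u
    using f A(1) by blast
  then have "f (s @ [True]) \<sqsubseteq> f t" "f (s @ [False]) \<sqsubseteq> f t"
    using z t D_carrier by (meson le_trans subsetD)+
  then show False
    by (auto simp: f_le prefix_def)
qed

end

theorem theorem3p12:
  fixes S :: "'a gorder"
  assumes "partial_order S"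
  shows "\<not> spatial (nuclei_frame (upset_frame S)) \<longleftrightarrow>
    (\<exists>A \<subseteq> carrier S. order_isomorphic binary_tree (subposet S A))"
proof -
  interpret poset S
    using assms by (rule poset.intro)
  show ?thesis
    using spatial_nuclei_if_no_binary_tree not_spatial_nuclei_if_binary_tree by blast
qed

end
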